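(* Let $k\ge 2$ be an integer and let $G$ be a minimally $k$-edge-connected graph. Then $mc_k(G)\le k-1$.
   Context: All graphs are finite, simple and undirected. A $k$-edge-connected graph has at least two vertices, and every two distinct vertices are joined by at least $k$ edge-disjoint paths. A $k$-edge-connected graph $G$ is minimally $k$-edge-connected if for no edge $e$ of $G$ the graph $G\setminus e$ is $k$-edge-connected. An edge-coloring assigns to each edge a color, where adjacent edges may receive the same color. A path is monochromatic if all its edges have the same color. For a $k$-edge-connected graph $G$, an $MC_k$-coloring of $G$ is an edge-coloring such that every two distinct vertices of $G$ are connected by at least $k$ pairwise edge-disjoint monochromatic paths (different paths may have different colors). The number $mc_k(G)$ is the maximum number of colors actually used by an $MC_k$-coloring of $G$. *)

theory Defs
  imports Main
begin

text \<open>A graph is a vertex set \<open>V\<close> together with an edge set \<open>E\<close>, each edge being an unordered pair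
  of distinct vertices; this excludes loops and multiple edges.\<close>

definition simple_graph :: "'a set \<Rightarrow> 'a set set \<Rightarrow> bool" where
  "simple_graph V E \<longleftrightarrow> finite V \<and> (\<forall>e\<in>E. \<exists>u\<in>V. \<exists>v\<in>V. u \<noteq> v \<and> e = {u, v})"

text \<open>A path is the list of the vertices it visits, without repetition.\<close>

fun path_edges :: "'a list \<Rightarrow> 'a set set" where
  "path_edges (x # y # xs) = insert {x, y} (path_edges (y # xs))"
| "path_edges _ = {}"

definition path_between :: "'a set \<Rightarrow> 'a set set \<Rightarrow> 'a \<Rightarrow> 'a \<Rightarrow> 'a list \<Rightarrow> bool" where
  "path_between V E u v p \<longleftrightarrow>
     p \<noteq> [] \<and> hd p = u \<and> last p = v \<and> distinct p \<and> set p \<subseteq> V \<and> path_edges p \<subseteq> E"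

definition edge_disjoint :: "'a list set \<Rightarrow> bool" where
  "edge_disjoint P \<longleftrightarrow> pairwise (\<lambda>p q. disjnt (path_edges p) (path_edges q)) P"

definition edge_connected :: "nat \<Rightarrow> 'a set \<Rightarrow> 'a set set \<Rightarrow> bool" where
  "edge_connected k V E \<longleftrightarrow>
     2 \<le> card V \<and>
     (\<forall>u\<in>V. \<forall>v\<in>V. u \<noteq> v \<longrightarrow>
        (\<exists>P. finite P \<and> k \<le> card P \<and> edge_disjoint P \<and> (\<forall>p\<in>P. path_between V E u v p)))"

definition minimally_edge_connected :: "nat \<Rightarrow> 'a set \<Rightarrow> 'a set set \<Rightarrow> bool" where
  "minimally_edge_connected k V E \<longleftrightarrow>
     edge_connected k V E \<and> (\<forall>e\<in>E. \<not> edge_connected k V (E - {e}))"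

definition monochromatic :: "('a set \<Rightarrow> 'c) \<Rightarrow> 'a list \<Rightarrow> bool" where
  "monochromatic c p \<longleftrightarrow> (\<exists>a. \<forall>e\<in>path_edges p. c e = a)"

definition MC_coloring :: "nat \<Rightarrow> 'a set \<Rightarrow> 'a set set \<Rightarrow> ('a set \<Rightarrow> 'c) \<Rightarrow> bool" where
  "MC_coloring k V E c \<longleftrightarrow>
     (\<forall>u\<in>V. \<forall>v\<in>V. u \<noteq> v \<longrightarrow>
        (\<exists>P. finite P \<and> k \<le> card P \<and> edge_disjoint P \<and>
             (\<forall>p\<in>P. path_between V E u v p \<and> monochromatic c p)))"

text \<open>Natural numbers serve as colors: \<open>E\<close> is finite, so every coloring, whatever its colors, can be
  renamed to this form. A coloring is a function on all sets, but only its values on \<open>E\<close> count.\<close>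

definition mc :: "nat \<Rightarrow> 'a set \<Rightarrow> 'a set set \<Rightarrow> nat" where
  "mc k V E = Max {card (c ` E) | c :: 'a set \<Rightarrow> nat. MC_coloring k V E c}"

text \<open>The maximum is well defined: for a \<open>k\<close>-edge-connected graph it ranges over a finite nonempty
  set.\<close>

lemma finite_edges: "simple_graph V E \<Longrightarrow> finite E"
  by (rule finite_subset[of _ "Pow V"]) (auto simp: simple_graph_def)

lemma finite_color_numbers:
  assumes "simple_graph V E"
  shows "finite {card (c ` E) | c :: 'a set \<Rightarrow> nat. MC_coloring k V E c}"
  by (rule finite_subset[of _ "{..card E}"])
     (auto intro: card_image_le finite_edges[OF assms])

lemma color_numbers_nonempty:
  assumes "edge_connected k V E"
  shows "{card (c ` E) | c :: 'a set \<Rightarrow> nat. MC_coloring k V E c} \<noteq> {}"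
proof -
  have "MC_coloring k V E (\<lambda>_. 0 :: nat)"
    using assms by (simp add: edge_connected_def MC_coloring_def monochromatic_def)
  then show ?thesis by blast
qed

end

theory Submission
  imports Defs
begin

text \<open>By Menger's theorem every edge of a minimally \<open>k\<close>-edge-connected graph lies in a cut with exactly
  \<open>k\<close> edges. Across such a tight cut, \<open>k\<close> edge-disjoint monochromatic paths use every cut edge, so each
  color of the cut connects any vertex on one side to any vertex on the other. Hence every color class
  is connected and spanning, and every tight cut contains all colors. If there were \<open>k\<close> colors, each
  tight cut would contain each color exactly once. Take an edge \<open>vw\<close> of color \<open>a\<close> and a path
  \<open>v, y, z, \<dots>, w\<close> of another color. Tight cuts through \<open>vy\<close> and \<open>yz\<close>, with sides \<open>X\<close> containing \<open>v\<close>
  and \<open>Y\<close> containing \<open>y\<close>, are crossed only once by the path, so \<open>vw\<close> is the only edge of color \<open>a\<close> in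
  either cut. Then no edge of color \<open>a\<close> leaves \<open>Y - X\<close>, which contains \<open>y\<close> but not \<open>v\<close>: a
  contradiction.\<close>

section \<open>Oriented arcs of paths, crossings and reachability\<close>

fun arcs :: "'a list \<Rightarrow> ('a \<times> 'a) set" where
  "arcs (x # y # xs) = insert (x, y) (arcs (y # xs))"
| "arcs _ = {}"

lemma path_edges_arcs: "path_edges p = (\<lambda>(x, y). {x, y}) ` arcs p"
  by (induction p rule: arcs.induct) auto

lemma arcs_subset: "(x, y) \<in> arcs p \<Longrightarrow> x \<in> set p \<and> y \<in> set p"
  by (induction p rule: arcs.induct) auto

lemma arcs_Cons: "p \<noteq> [] \<Longrightarrow> arcs (x # p) = insert (x, hd p) (arcs p)"
  by (cases p) auto

lemma arcs_append_mono: "arcs q \<subseteq> arcs (p @ q)"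
proof (induction p)
  case (Cons a p)
  then show ?case by (cases "p @ q") auto
qed simp

lemma arcs_antisym: "distinct p \<Longrightarrow> (x, y) \<in> arcs p \<Longrightarrow> (y, x) \<notin> arcs p"
  by (induction p rule: arcs.induct) (auto dest: arcs_subset)

lemma arcs_crossing:
  assumes "p \<noteq> []" "hd p \<in> S" "last p \<notin> S"
  shows "\<exists>x y. (x, y) \<in> arcs p \<and> x \<in> S \<and> y \<notin> S"
  using assms by (induction p rule: arcs.induct) (auto split: if_splits)

lemma rtrancl_crossing:
  assumes "(u, v) \<in> r\<^sup>*" "u \<in> S" "v \<notin> S"
  shows "\<exists>x y. (x, y) \<in> r \<and> x \<in> S \<and> y \<notin> S"
  using assms by (induction rule: converse_rtrancl_induct) auto

lemma arcs_rtrancl: "p \<noteq> [] \<Longrightarrow> arcs p \<subseteq> r \<Longrightarrow> (hd p, last p) \<in> r\<^sup>*"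
  by (induction p rule: arcs.induct) (auto intro: converse_rtrancl_into_rtrancl)

text \<open>Meant for tails of a distinct path: once \<open>v\<close> has been left behind, the tail
  can enter a set only along edges not incident with \<open>v\<close>.\<close>

lemma arcs_rtrancl_avoiding:
  assumes "p \<noteq> []" "arcs p \<subseteq> r" "v \<notin> set p"
  shows "(hd p, last p) \<in> (r \<inter> (- {v}) \<times> (- {v}))\<^sup>*"
proof (rule arcs_rtrancl[OF assms(1)])
  have "s \<noteq> v \<and> t \<noteq> v" if "(s, t) \<in> arcs p" for s t
    using arcs_subset[OF that] assms(3) by auto
  then show "arcs p \<subseteq> r \<inter> (- {v}) \<times> (- {v})" using assms(2) by auto
qed

lemma rtrancl_distinct_path:
  assumes "(u, v) \<in> r\<^sup>*"
  shows "\<exists>p. p \<noteq> [] \<and> hd p = u \<and> last p = v \<and> distinct p \<and> set p \<subseteq> insert u (Range r) \<and> arcs p \<subseteq> r"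
  using assms
proof (induction rule: converse_rtrancl_induct)
  case base
  show ?case by (rule exI[of _ "[v]"]) auto
next
  case (step u w)
  then obtain p where p: "p \<noteq> []" "hd p = w" "last p = v" "distinct p"
    "set p \<subseteq> insert w (Range r)" "arcs p \<subseteq> r" by blast
  have sub: "set p \<subseteq> insert u (Range r)" using p(5) step(1) by auto
  show ?case
  proof (cases "u \<in> set p")
    case True
    \<comment> \<open>If \<open>u\<close> is already on the path, the part before its occurrence is
      dropped, so no vertex repeats.\<close>
    then obtain ys zs where q: "p = ys @ u # zs" by (meson split_list)
    have "arcs (u # zs) \<subseteq> r" using p(6) arcs_append_mono[of "u # zs" ys] q by blast
    then show ?thesis using p sub q by (intro exI[of _ "u # zs"]) auto
  next
    case False
    then show ?thesis using p sub step(1)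
      by (intro exI[of _ "u # p"]) (auto simp: arcs_Cons)
  qed
qed

subsection \<open>Unit flows and Menger's theorem\<close>

definition path_flow :: "'a list \<Rightarrow> 'a \<Rightarrow> 'a \<Rightarrow> int" where
  "path_flow p x y = of_bool ((x, y) \<in> arcs p) - of_bool ((y, x) \<in> arcs p)"

text \<open>A skew-symmetric function encodes an orientation of some of the edges, so that pushing flow
  along a path and cancelling it are both plain addition.\<close>

definition unit_flow :: "'a set \<Rightarrow> 'a set set \<Rightarrow> 'a \<Rightarrow> 'a \<Rightarrow> nat \<Rightarrow> ('a \<Rightarrow> 'a \<Rightarrow> int) \<Rightarrow> bool" where
  "unit_flow V E u v r f \<longleftrightarrow>
     (\<forall>x y. f y x = - f x y) \<and> (\<forall>x y. f x y \<le> 1) \<and> (\<forall>x y. {x, y} \<notin> E \<longrightarrow> f x y = 0) \<and>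
     (\<forall>x\<in>V - {u, v}. (\<Sum>y\<in>V. f x y) = 0) \<and> (\<Sum>y\<in>V. f u y) = int r"

lemma unit_flowD:
  assumes "unit_flow V E u v r f"
  shows "f y x = - f x y" "f x y \<le> 1" "{x, y} \<notin> E \<Longrightarrow> f x y = 0"
    "x \<in> V \<Longrightarrow> x \<noteq> u \<Longrightarrow> x \<noteq> v \<Longrightarrow> (\<Sum>y\<in>V. f x y) = 0" "(\<Sum>y\<in>V. f u y) = int r"
  using assms unfolding unit_flow_def by blast+

lemma path_flow_skew: "path_flow p y x = - path_flow p x y"
  by (simp add: path_flow_def)

lemma path_flow_arc: "distinct p \<Longrightarrow> (x, y) \<in> arcs p \<Longrightarrow> path_flow p x y = 1"
  by (auto simp: path_flow_def dest: arcs_antisym)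

lemma path_flow_off: "{x, y} \<notin> path_edges p \<Longrightarrow> path_flow p x y = 0"
  by (force simp: path_flow_def path_edges_arcs insert_commute)

lemma path_flow_le: "path_flow p x y \<le> of_bool ((x, y) \<in> arcs p)"
  by (simp add: path_flow_def)

lemma path_flow_net:
  assumes "finite V" "distinct p" "p \<noteq> []" "set p \<subseteq> V"
  shows "(\<Sum>y\<in>V. path_flow p x y) = of_bool (x = hd p) - of_bool (x = last p)"
  using assms(2-)
proof (induction p rule: arcs.induct)
  case (1 a b p)
  \<comment> \<open>Prepending \<open>a\<close> adds the flow of the single arc from
    \<open>a\<close> to \<open>b\<close>. By distinctness \<open>a\<close> occurs in no later arc,
    so the indicators do not overlap, and the net flows telescope.\<close>
  have "path_flow (a # b # p) x y =
      of_bool (x = a) * of_bool (y = b) - of_bool (x = b) * of_bool (y = a) + path_flow (b # p) x y" for y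
    using 1(2) arcs_subset[of a _ "b # p"] arcs_subset[of _ a "b # p"]
    by (auto simp: path_flow_def)
  moreover have "(\<Sum>y\<in>V. of_bool (y = z) :: int) = 1" if "z \<in> V" for z
    using assms(1) that by (simp add: of_bool_def)
  ultimately show ?case using 1 by (auto simp: sum.distrib sum_subtractf simp flip: sum_distrib_left)
qed (auto simp: path_flow_def)

text \<open>Pairs inside \<open>S\<close> cancel by skew-symmetry; only pairs leaving
  \<open>S\<close> remain.\<close>

lemma net_sum_crossing:
  fixes f :: "'a \<Rightarrow> 'a \<Rightarrow> int"
  assumes "finite V" "S \<subseteq> V" and skew: "\<And>x y. f y x = - f x y"
  shows "(\<Sum>x\<in>S. \<Sum>y\<in>V. f x y) = (\<Sum>x\<in>S. \<Sum>y\<in>V - S. f x y)"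
proof -
  have "(\<Sum>x\<in>S. \<Sum>y\<in>S. f x y) = (\<Sum>x\<in>S. \<Sum>y\<in>S. f y x)" by (rule sum.swap)
  also have "\<dots> = (\<Sum>x\<in>S. \<Sum>y\<in>S. - f x y)" by (intro sum.cong refl skew)
  also have "\<dots> = - (\<Sum>x\<in>S. \<Sum>y\<in>S. f x y)" by (simp add: sum_negf)
  finally have "(\<Sum>x\<in>S. \<Sum>y\<in>S. f x y) = 0" by simp
  moreover have "(\<Sum>y\<in>V. f x y) = (\<Sum>y\<in>V - S. f x y) + (\<Sum>y\<in>S. f x y)" for x
    by (rule sum.subset_diff) (use assms in auto)
  ultimately show ?thesis by (simp add: sum.distrib)
qed

text \<open>By conservation only \<open>u\<close> contributes to the net outflow of
  \<open>S\<close>, so every cut separating \<open>u\<close> from \<open>v\<close> carries the whole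
  flow.\<close>

lemma unit_flow_crossing:
  assumes f: "unit_flow V E u v r f" and "finite V" "S \<subseteq> V" "u \<in> S" "v \<notin> S"
  shows "(\<Sum>x\<in>S. \<Sum>y\<in>V - S. f x y) = int r"
proof -
  have "(\<Sum>x\<in>S. \<Sum>y\<in>V - S. f x y) = (\<Sum>x\<in>S. \<Sum>y\<in>V. f x y)"
    using net_sum_crossing[OF assms(2,3), of f] unit_flowD(1)[OF f] by metis
  also have "\<dots> = (\<Sum>x\<in>S. if x = u then int r else 0)"
    using unit_flowD(4,5)[OF f] assms(3,5) by (intro sum.cong) auto
  also have "\<dots> = int r" using finite_subset[OF assms(3,2)] assms(4) by simp
  finally show ?thesis .
qed

lemma unit_flow_path:
  assumes f: "unit_flow V E u v (Suc r) f" and "finite V" "u \<in> V"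
  shows "(u, v) \<in> {(x, y). f x y = 1}\<^sup>*"
proof (rule ccontr)
  assume nr: "\<not> ?thesis"
  \<comment> \<open>If \<open>v\<close> is unreachable along arcs carrying a full unit, then by
    integrality no positive flow leaves the reachable set \<open>S\<close>, although the flow across
    must be \<open>Suc r\<close>.\<close>
  define S where "S = {x \<in> V. (u, x) \<in> {(x, y). f x y = 1}\<^sup>*}"
  have "f x y \<le> 0" if "x \<in> S" "y \<in> V - S" for x y
  proof -
    have "f x y \<noteq> 1"
    proof
      assume "f x y = 1"
      then have "(u, y) \<in> {(x, y). f x y = 1}\<^sup>*"
        using that unfolding S_def by (blast intro: rtrancl_into_rtrancl)
      then show False using that by (simp add: S_def)
    qed
    moreover have "f x y \<le> 1" using unit_flowD(2)[OF f] .
    ultimately show ?thesis by linarith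
  qed
  then have "(\<Sum>x\<in>S. \<Sum>y\<in>V - S. f x y) \<le> 0" by (intro sum_nonpos) auto
  moreover have "(\<Sum>x\<in>S. \<Sum>y\<in>V - S. f x y) = int (Suc r)"
    by (rule unit_flow_crossing[OF f]) (use assms(2,3) nr in \<open>auto simp: S_def\<close>)
  ultimately show False by simp
qed

text \<open>Paths are peeled off one at a time: the flow along \<open>p\<close> is subtracted and
  the edges of \<open>p\<close> are deleted, so the paths found afterwards are edge-disjoint from
  \<open>p\<close>.\<close>

lemma unit_flow_disjoint_paths:
  assumes "unit_flow V E u v r f" "finite V" "u \<in> V" "u \<noteq> v" "\<Union>E \<subseteq> V"
  shows "\<exists>P. finite P \<and> card P = r \<and> edge_disjoint P \<and> (\<forall>p\<in>P. path_between V E u v p)"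
  using assms
proof (induction r arbitrary: E f)
  case 0
  show ?case by (rule exI[of _ "{}"]) (simp add: edge_disjoint_def)
next
  case (Suc r)
  let ?r = "{(x, y). f x y = 1}"
  have sub: "{x, y} \<in> E" if "f x y = 1" for x y
    using unit_flowD(3)[OF Suc.prems(1), of x y] that by force
  have "(u, v) \<in> ?r\<^sup>*" using unit_flow_path[OF Suc.prems(1,2,3)] .
  from rtrancl_distinct_path[OF this] obtain p where p: "p \<noteq> []" "hd p = u" "last p = v"
    "distinct p" "set p \<subseteq> insert u (Range ?r)" and arcs: "arcs p \<subseteq> ?r" by blast
  have "Range ?r \<subseteq> \<Union>E" using sub by auto
  then have "insert u (Range ?r) \<subseteq> V" using Suc.prems(3,5) by simp
  with p(5) have pV: "set p \<subseteq> V" by (rule order_trans)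
  have pE: "path_edges p \<subseteq> E" using arcs sub by (auto simp: path_edges_arcs)
  have pne: "path_edges p \<noteq> {}" using arcs_crossing[of p "{u}"] p \<open>u \<noteq> v\<close> by (auto simp: path_edges_arcs)
  let ?g = "\<lambda>x y. f x y - path_flow p x y"
  have "unit_flow V (E - path_edges p) u v r ?g"
    unfolding unit_flow_def
  proof (intro conjI allI ballI impI)
    fix x y
    show "?g y x = - ?g x y" using unit_flowD(1)[OF Suc.prems(1), of y x] path_flow_skew[of p y x] by simp
  next
    fix x y
    have skew: "f y x = - f x y" by (rule unit_flowD(1)[OF Suc.prems(1)])
    \<comment> \<open>Subtracting the path flow raises a value only against the direction of
      \<open>p\<close>, where \<open>f\<close> is -1.\<close>
    show "?g x y \<le> 1"
    proof (cases "(y, x) \<in> arcs p")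
      case True
      then have "f y x = 1" using arcs by auto
      then show ?thesis using path_flow_arc[OF p(4) True] path_flow_skew[of p y x] skew by simp
    next
      case False
      then have "path_flow p x y \<ge> 0" by (simp add: path_flow_def)
      moreover have "f x y \<le> 1" using unit_flowD(2)[OF Suc.prems(1)] .
      ultimately show ?thesis by simp
    qed
    show "?g x y = 0" if "{x, y} \<notin> E - path_edges p"
    proof (cases "{x, y} \<in> path_edges p")
      case True
      then consider "(x, y) \<in> arcs p" | "(y, x) \<in> arcs p"
        by (auto simp: path_edges_arcs doubleton_eq_iff)
      then show ?thesis
      proof cases
        case 1
        then show ?thesis using arcs path_flow_arc[OF p(4) 1] by auto
      next
        case 2
        then have "f y x = 1" using arcs by auto
        then show ?thesis using path_flow_arc[OF p(4) 2] path_flow_skew[of p y x] skew by simp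
      qed
    next
      case False
      then show ?thesis using that unit_flowD(3)[OF Suc.prems(1), of x y] path_flow_off[OF False] by simp
    qed
  next
    fix x assume "x \<in> V - {u, v}"
    then show "(\<Sum>y\<in>V. ?g x y) = 0"
      using unit_flowD(4)[OF Suc.prems(1), of x] path_flow_net[OF Suc.prems(2) p(4,1) pV, of x] p(2,3)
      by (simp add: sum_subtractf)
  next
    show "(\<Sum>y\<in>V. ?g u y) = int r"
      using unit_flowD(5)[OF Suc.prems(1)] Suc.prems(4) path_flow_net[OF Suc.prems(2) p(4,1) pV, of u] p(2,3)
      by (simp add: sum_subtractf)
  qed
  then obtain P where P: "finite P" "card P = r" "edge_disjoint P"
    "\<forall>q\<in>P. path_between V (E - path_edges p) u v q"
    using Suc.IH[of "E - path_edges p" ?g, OF _ Suc.prems(2-4)] Union_mono[OF Diff_subset] Suc.prems(5)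
    by (metis order_trans)
  have dj: "disjnt (path_edges p) (path_edges q)" if "q \<in> P" for q
    using P(4) that by (auto simp: path_between_def disjnt_def)
  \<comment> \<open>A path with an edge is not disjoint from itself, so \<open>p\<close> is new and
    the count grows by one.\<close>
  then have "p \<notin> P" using pne by (auto simp: disjnt_def)
  then show ?case using P dj p pV pE
    by (intro exI[of _ "insert p P"])
      (auto simp: edge_disjoint_def pairwise_insert path_between_def disjnt_sym)
qed

text \<open>\<open>S\<close> may be any set, not just a subset of \<open>V\<close>, so that
  \<open>- S\<close> is available as the other side of the same cut.\<close>

definition edge_cut :: "'a set set \<Rightarrow> 'a set \<Rightarrow> 'a set set" where
  "edge_cut E S = {e \<in> E. \<exists>x y. e = {x, y} \<and> x \<in> S \<and> y \<notin> S}"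

lemma edge_cut_doubleton: "{x, y} \<in> edge_cut E S \<longleftrightarrow> {x, y} \<in> E \<and> (x \<in> S \<longleftrightarrow> y \<notin> S)"
  unfolding edge_cut_def by (auto simp: doubleton_eq_iff)

lemma edge_cut_Compl: "edge_cut E (- S) = edge_cut E S"
  unfolding edge_cut_def by (auto simp: insert_commute)

lemma unit_flow_augment:
  assumes f: "unit_flow V E u v r f" and "finite V" "u \<noteq> v" "u \<in> V" and E: "\<Union>E \<subseteq> V"
    and "(u, v) \<in> {(x, y). {x, y} \<in> E \<and> f x y < 1}\<^sup>*" (is "_ \<in> ?r\<^sup>*")
  shows "\<exists>g. unit_flow V E u v (Suc r) g"
proof -
  obtain p where p: "p \<noteq> []" "hd p = u" "last p = v"
    "distinct p" "set p \<subseteq> insert u (Range ?r)" and arcs: "arcs p \<subseteq> ?r"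
    using rtrancl_distinct_path[OF assms(6)] by blast
  have "Range ?r \<subseteq> \<Union>E" by auto
  then have "insert u (Range ?r) \<subseteq> V" using assms(4) E by simp
  with p(5) have pV: "set p \<subseteq> V" by (rule order_trans)
  have pE: "path_edges p \<subseteq> E" using arcs by (auto simp: path_edges_arcs)
  let ?g = "\<lambda>x y. f x y + path_flow p x y"
  have "unit_flow V E u v (Suc r) ?g"
    unfolding unit_flow_def
  proof (intro conjI allI ballI impI)
    fix x y
    show "?g y x = - ?g x y" using unit_flowD(1)[OF f, of y x] path_flow_skew[of p y x] by simp
  next
    fix x y
    show "?g x y \<le> 1"
    proof (cases "(x, y) \<in> arcs p")
      case True
      then show ?thesis using path_flow_le[of p x y] arcs by auto
    next
      case False
      moreover have "f x y \<le> 1" using unit_flowD(2)[OF f] .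
      ultimately show ?thesis using path_flow_le[of p x y] by simp
    qed
    show "?g x y = 0" if "{x, y} \<notin> E"
      using that pE unit_flowD(3)[OF f] path_flow_off[of x y p] by auto
  next
    fix x assume "x \<in> V - {u, v}"
    then show "(\<Sum>y\<in>V. ?g x y) = 0"
      using unit_flowD(4)[OF f, of x] path_flow_net[OF assms(2) p(4,1) pV, of x] p(2,3)
      by (simp add: sum.distrib)
  next
    show "(\<Sum>y\<in>V. ?g u y) = int (Suc r)"
      using unit_flowD(5)[OF f] assms(3) path_flow_net[OF assms(2) p(4,1) pV, of u] p(2,3)
      by (simp add: sum.distrib)
  qed
  then show ?thesis by blast
qed

text \<open>Every edge leaving the residually reachable set carries exactly one unit outward, so the
  value of the flow counts the edges of that cut.\<close>

lemma unit_flow_saturated_cut: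
  assumes f: "unit_flow V E u v r f" and "finite V" "u \<in> V" and E: "\<Union>E \<subseteq> V"
    and nr: "(u, v) \<notin> {(x, y). {x, y} \<in> E \<and> f x y < 1}\<^sup>*" (is "_ \<notin> ?r\<^sup>*")
  shows "\<exists>S\<subseteq>V. u \<in> S \<and> v \<notin> S \<and> card (edge_cut E S) = r"
proof -
  define S where "S = {x \<in> V. (u, x) \<in> ?r\<^sup>*}"
  have S: "S \<subseteq> V" "u \<in> S" "v \<notin> S" using nr assms(3) by (auto simp: S_def)
  have fin: "finite S" using S(1) assms(2) finite_subset by blast
  have val: "f x y = of_bool ({x, y} \<in> E)" if "x \<in> S" "y \<in> V - S" for x y
  proof (cases "{x, y} \<in> E")
    case True
    have "\<not> f x y < 1"
    proof
      assume "f x y < 1"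
      then have "(u, y) \<in> ?r\<^sup>*"
        using that True unfolding S_def by (blast intro: rtrancl_into_rtrancl)
      then show False using that by (simp add: S_def)
    qed
    moreover have "f x y \<le> 1" using unit_flowD(2)[OF f] .
    ultimately show ?thesis using True by simp
  qed (simp add: unit_flowD(3)[OF f])
  \<comment> \<open>Each cut edge has exactly one orientation from \<open>S\<close> outward, so
    \<open>B\<close> has as many elements as the cut.\<close>
  define B where "B = {(x, y) \<in> S \<times> (V - S). {x, y} \<in> E}"
  have "int r = (\<Sum>x\<in>S. \<Sum>y\<in>V - S. f x y)"
    using unit_flow_crossing[OF f assms(2) S] by simp
  also have "\<dots> = (\<Sum>x\<in>S. \<Sum>y\<in>V - S. of_bool ({x, y} \<in> E))" using val by (intro sum.cong) auto
  also have "\<dots> = (\<Sum>z\<in>S \<times> (V - S). of_bool ({fst z, snd z} \<in> E))"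
    by (simp add: sum.cartesian_product split_def)
  also have "\<dots> = int (card B)"
    using fin assms(2) by (simp add: sum_of_bool_eq B_def) (rule arg_cong[where f = card], auto)
  finally have "card B = r" by simp
  moreover have "edge_cut E S = (\<lambda>(x, y). {x, y}) ` B"
    using S(1) E by (auto simp: edge_cut_def B_def image_iff doubleton_eq_iff)
  moreover have "inj_on (\<lambda>(x, y). {x, y}) B" by (auto simp: inj_on_def B_def doubleton_eq_iff)
  ultimately have "card (edge_cut E S) = r" by (simp add: card_image)
  then show ?thesis using S by blast
qed

text \<open>Augmentation starts from the zero flow and can stop only at a saturated cut with
  \<open>r\<close> edges, which is excluded as long as \<open>r < k\<close>. The final flow is then
  split into paths.\<close>

theorem menger_edge:
  assumes "finite V" "u \<in> V" "u \<noteq> v" and E: "\<Union>E \<subseteq> V"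
    and cuts: "\<And>S. S \<subseteq> V \<Longrightarrow> u \<in> S \<Longrightarrow> v \<notin> S \<Longrightarrow> k \<le> card (edge_cut E S)"
  shows "\<exists>P. finite P \<and> card P = k \<and> edge_disjoint P \<and> (\<forall>p\<in>P. path_between V E u v p)"
proof -
  have "\<exists>f. unit_flow V E u v r f" if "r \<le> k" for r
    using that
  proof (induction r)
    case 0
    show ?case by (rule exI[of _ "\<lambda>_ _. 0"]) (simp add: unit_flow_def)
  next
    case (Suc r)
    then obtain f where f: "unit_flow V E u v r f" using Suc.IH[OF Suc_leD] by metis
    have "(u, v) \<in> {(x, y). {x, y} \<in> E \<and> f x y < 1}\<^sup>*"
    proof (rule ccontr)
      assume "\<not> ?thesis"
      from unit_flow_saturated_cut[OF f assms(1,2) E this]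
      obtain S where "S \<subseteq> V" "u \<in> S" "v \<notin> S" "card (edge_cut E S) = r" by blast
      then show False using cuts[of S] Suc.prems by simp
    qed
    from unit_flow_augment[OF f assms(1,3,2) E this] show ?case .
  qed
  from this[OF order_refl] obtain f where "unit_flow V E u v k f" ..
  from unit_flow_disjoint_paths[OF this assms(1-3) E] show ?thesis .
qed

subsection \<open>Tight cuts\<close>

lemma path_meets_cut:
  assumes "path_between V E u v p" "u \<in> S" "v \<notin> S"
  shows "path_edges p \<inter> edge_cut E S \<noteq> {}"
proof -
  have p: "p \<noteq> []" "hd p = u" "last p = v" "path_edges p \<subseteq> E"
    using assms by (auto simp: path_between_def)
  then obtain x y where xy: "(x, y) \<in> arcs p" "x \<in> S" "y \<notin> S"
    using arcs_crossing[of p S] assms by blast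
  then have "{x, y} \<in> path_edges p" by (force simp: path_edges_arcs)
  moreover have "{x, y} \<in> edge_cut E S" using calculation xy(2,3) p(4) by (auto simp: edge_cut_doubleton)
  ultimately show ?thesis by blast
qed

text \<open>Picking one cut edge on each path is injective by disjointness. If there are as many
  paths as cut edges, it is also onto, so the paths use up the cut.\<close>

lemma disjoint_paths_cut:
  assumes "edge_disjoint P" "\<forall>p\<in>P. path_between V E u v p" "u \<in> S" "v \<notin> S" "finite E"
  shows "card P \<le> card (edge_cut E S)"
    and "card (edge_cut E S) \<le> card P \<Longrightarrow> e \<in> edge_cut E S \<Longrightarrow> \<exists>p\<in>P. e \<in> path_edges p"
proof -
  define g where "g p = (SOME e. e \<in> path_edges p \<inter> edge_cut E S)" for p
  have g: "g p \<in> path_edges p \<inter> edge_cut E S" if "p \<in> P" for p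
  proof -
    have "path_between V E u v p" using assms(2) that by (rule bspec)
    then have "path_edges p \<inter> edge_cut E S \<noteq> {}" using assms(3,4) by (rule path_meets_cut)
    then show ?thesis unfolding g_def by (simp only: some_in_eq not_False_eq_True)
  qed
  have inj: "inj_on g P"
  proof (rule inj_onI, rule ccontr)
    fix p q assume pq: "p \<in> P" "q \<in> P" "g p = g q" "p \<noteq> q"
    then have "path_edges p \<inter> path_edges q = {}"
      using assms(1) by (simp add: edge_disjoint_def pairwise_def disjnt_def)
    then show False using g[OF pq(1)] g[OF pq(2)] pq(3) by auto
  qed
  have sub: "g ` P \<subseteq> edge_cut E S" using g by auto
  have fin: "finite (edge_cut E S)" using assms(5) by (simp add: edge_cut_def)
  show "card P \<le> card (edge_cut E S)" using card_inj_on_le[OF inj sub fin] .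
  assume "card (edge_cut E S) \<le> card P" "e \<in> edge_cut E S"
  then have "g ` P = edge_cut E S" using card_seteq[OF fin sub] card_image[OF inj] by simp
  then obtain p where "p \<in> P" "e = g p" using \<open>e \<in> edge_cut E S\<close> by (metis imageE)
  then show "\<exists>p\<in>P. e \<in> path_edges p" using g[of p] by auto
qed

lemma simple_graph_doubleton: "simple_graph V E \<Longrightarrow> {x, y} \<in> E \<Longrightarrow> x \<in> V \<and> y \<in> V \<and> x \<noteq> y"
  by (fastforce simp: simple_graph_def doubleton_eq_iff)

text \<open>Deleting \<open>e\<close> destroys connectivity for some pair, so Menger yields a cut
  with fewer than \<open>k\<close> edges left. The paths in the full graph force at least
  \<open>k\<close> before deletion; hence \<open>e\<close> makes the difference.\<close>

lemma minimally_edge_connected_tight_cut: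
  assumes G: "simple_graph V E" and min: "minimally_edge_connected k V E" and e: "e \<in> E"
  shows "\<exists>S u v. u \<in> V \<inter> S \<and> v \<in> V - S \<and> e \<in> edge_cut E S \<and> card (edge_cut E S) = k"
proof -
  have conn: "edge_connected k V E" and "\<not> edge_connected k V (E - {e})"
    using min e by (auto simp: minimally_edge_connected_def)
  then obtain u v where uv: "u \<in> V" "v \<in> V" "u \<noteq> v"
    and no: "\<not> (\<exists>P. finite P \<and> k \<le> card P \<and> edge_disjoint P \<and> (\<forall>p\<in>P. path_between V (E - {e}) u v p))"
    unfolding edge_connected_def by blast
  have "\<exists>S\<subseteq>V. u \<in> S \<and> v \<notin> S \<and> card (edge_cut (E - {e}) S) < k"
  proof (rule ccontr)
    assume "\<not> ?thesis"
    then have "\<exists>P. finite P \<and> card P = k \<and> edge_disjoint P \<and> (\<forall>p\<in>P. path_between V (E - {e}) u v p)"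
    proof (intro menger_edge)
      show "finite V" "\<Union>(E - {e}) \<subseteq> V" using G by (auto simp: simple_graph_def)
    qed (use uv in \<open>auto simp: not_less\<close>)
    then show False using no by auto
  qed
  then obtain S where S: "u \<in> S" "v \<notin> S" "card (edge_cut (E - {e}) S) < k" by blast
  obtain P where P: "k \<le> card P" "edge_disjoint P" "\<forall>p\<in>P. path_between V E u v p"
    using conn uv unfolding edge_connected_def by blast
  have ge: "k \<le> card (edge_cut E S)"
    using disjoint_paths_cut(1)[OF P(2,3) S(1,2) finite_edges[OF G]] P(1) by linarith
  have eq: "edge_cut (E - {e}) S = edge_cut E S - {e}" by (auto simp: edge_cut_def)
  have "e \<in> edge_cut E S" using S(3) ge eq by (cases "e \<in> edge_cut E S") auto
  moreover from this have "card (edge_cut E S) = k"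
    using S(3) ge eq finite_edges[OF G] by (simp add: edge_cut_def)
  ultimately show ?thesis using S uv by blast
qed

subsection \<open>Color classes\<close>

text \<open>A color class as a symmetric relation, so that its connectedness can be stated by
  reflexive transitive closure.\<close>

definition color_arcs :: "'a set set \<Rightarrow> ('a set \<Rightarrow> 'c) \<Rightarrow> 'c \<Rightarrow> ('a \<times> 'a) set" where
  "color_arcs E c a = {(x, y). {x, y} \<in> E \<and> c {x, y} = a}"

lemma sym_color_arcs: "sym (color_arcs E c a)"
  by (auto simp: sym_def color_arcs_def insert_commute)

text \<open>The disjoint monochromatic paths exhaust the tight cut, so one of them passes through
  \<open>e\<close> and has its color throughout.\<close>

lemma tight_cut_color_connects:
  assumes G: "simple_graph V E" and col: "MC_coloring k V E c"
    and "u \<in> V \<inter> S" "v \<in> V - S" "e \<in> edge_cut E S" "card (edge_cut E S) = k"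
  shows "(u, v) \<in> (color_arcs E c (c e))\<^sup>*"
proof -
  obtain P where P: "k \<le> card P" "edge_disjoint P"
    and path: "\<forall>p\<in>P. path_between V E u v p \<and> monochromatic c p"
  proof -
    have "u \<in> V" "v \<in> V" "u \<noteq> v" using assms(3,4) by auto
    then show ?thesis using col that unfolding MC_coloring_def by metis
  qed
  then obtain p where p: "p \<in> P" "e \<in> path_edges p"
    using disjoint_paths_cut(2)[OF P(2) _ _ _ finite_edges[OF G], of V u v S e] assms by auto
  then have "\<forall>e'\<in>path_edges p. c e' = c e" using path by (auto simp: monochromatic_def)
  then have "arcs p \<subseteq> color_arcs E c (c e)"
    using path p(1) by (force simp: path_edges_arcs color_arcs_def path_between_def)
  then show ?thesis using arcs_rtrancl path p(1) by (metis path_between_def)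
qed

lemma color_class_connected:
  assumes G: "simple_graph V E" and min: "minimally_edge_connected k V E"
    and col: "MC_coloring k V E c" and "e \<in> E" "x \<in> V" "y \<in> V"
  shows "(x, y) \<in> (color_arcs E c (c e))\<^sup>*"
proof -
  let ?r = "(color_arcs E c (c e))\<^sup>*"
  obtain S u v where S: "u \<in> V \<inter> S" "v \<in> V - S" "e \<in> edge_cut E S" "card (edge_cut E S) = k"
    using minimally_edge_connected_tight_cut[OF G min \<open>e \<in> E\<close>] by blast
  have across: "(s, t) \<in> ?r" if "s \<in> V \<inter> S" "t \<in> V - S" for s t
    using tight_cut_color_connects[OF G col that S(3,4)] .
  have sym: "sym ?r" by (intro sym_rtrancl sym_color_arcs)
  \<comment> \<open>A vertex on the same side as \<open>v\<close> is reached by crossing the cut to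
    \<open>u\<close> and back.\<close>
  have "(z, v) \<in> ?r" if "z \<in> V" for z
  proof (cases "z \<in> S")
    case False
    then have "(z, u) \<in> ?r" using across[of u z] S that symD[OF sym] by blast
    then show ?thesis using across[OF S(1,2)] by (rule rtrancl_trans)
  qed (use across S that in blast)
  then show ?thesis using assms symD[OF sym] rtrancl_trans by metis
qed

lemma connected_color_meets_cut:
  assumes "(x, y) \<in> (color_arcs E c a)\<^sup>*" "x \<in> S" "y \<notin> S"
  shows "\<exists>s t. s \<in> S \<and> t \<notin> S \<and> {s, t} \<in> edge_cut E S \<and> c {s, t} = a"
  using rtrancl_crossing[OF assms] by (fastforce simp: color_arcs_def edge_cut_doubleton)

text \<open>Each color class connects all of \<open>V\<close>, so it must cross any cut with
  vertices of \<open>V\<close> on both sides.\<close>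

lemma tight_cut_all_colors:
  assumes G: "simple_graph V E" and min: "minimally_edge_connected k V E"
    and col: "MC_coloring k V E c" and "u \<in> V \<inter> S" "v \<in> V - S"
  shows "c ` E \<subseteq> c ` edge_cut E S"
proof
  fix a assume "a \<in> c ` E"
  then have "(u, v) \<in> (color_arcs E c a)\<^sup>*" using color_class_connected[OF G min col] assms by auto
  then show "a \<in> c ` edge_cut E S" using connected_color_meets_cut assms by fastforce
qed

section \<open>The bound on the number of colors\<close>

lemma MC_coloring_bound:
  assumes "k \<ge> 2" and G: "simple_graph V E" and min: "minimally_edge_connected k V E"
    and col: "MC_coloring k V E c"
  shows "card (c ` E) < k"
proof (rule ccontr)
  assume "\<not> card (c ` E) < k"
  then have many: "k \<le> card (c ` E)" by simp
  have finE: "finite E" using finite_edges[OF G] .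
  \<comment> \<open>A tight cut has \<open>k\<close> edges and shows all of the at least
    \<open>k\<close> colors, so no color repeats in it. Passing to the complement if necessary puts
    \<open>x\<close> inside.\<close>
  have tight: "\<exists>S. x \<in> S \<and> y \<notin> S \<and> inj_on c (edge_cut E S)" if xy: "{x, y} \<in> E" for x y
  proof -
    obtain S u v where S: "u \<in> V \<inter> S" "v \<in> V - S" "{x, y} \<in> edge_cut E S" "card (edge_cut E S) = k"
      using minimally_edge_connected_tight_cut[OF G min xy] by blast
    have fin: "finite (edge_cut E S)" using finE by (simp add: edge_cut_def)
    have "k \<le> card (c ` edge_cut E S)"
      using many card_mono[OF finite_imageI[OF fin] tight_cut_all_colors[OF G min col S(1,2)]] by linarith
    then have inj: "inj_on c (edge_cut E S)"
      using S(4) fin card_image_le[OF fin, of c] by (intro eq_card_imp_inj_on) auto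
    show ?thesis
    proof (cases "x \<in> S")
      case True
      then show ?thesis using inj S(3) by (auto simp: edge_cut_doubleton)
    next
      case False
      then show ?thesis using inj S(3) by (intro exI[of _ "- S"]) (auto simp: edge_cut_doubleton edge_cut_Compl)
    qed
  qed
  have "\<not> card (c ` E) \<le> Suc 0" using many assms(1) by simp
  then obtain e e' where ee: "e \<in> E" "e' \<in> E" "c e \<noteq> c e'"
    by (auto simp: card_le_Suc0_iff_eq finE)
  obtain v w where vw: "e = {v, w}" "v \<in> V" "w \<in> V" "v \<noteq> w"
    using G ee(1) by (auto simp: simple_graph_def)
  let ?b = "color_arcs E c (c e')"
  have "(v, w) \<in> ?b\<^sup>*" using color_class_connected[OF G min col ee(2) vw(2,3)] .
  from rtrancl_distinct_path[OF this] obtain p where p: "p \<noteq> []" "hd p = v" "last p = w"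
    "distinct p" "arcs p \<subseteq> ?b" by blast
  \<comment> \<open>The edge \<open>vw\<close> has the color of \<open>e\<close>, not that of
    \<open>e'\<close>, so \<open>p\<close> has at least two edges.\<close>
  have "\<exists>y z q. p = v # y # z # q"
  proof (cases p rule: remdups_adj.cases)
    case (3 a y q)
    then have "(v, y) \<in> ?b" using p by simp
    then have "y \<noteq> w" using ee vw(1) by (auto simp: color_arcs_def)
    then show ?thesis using 3 p by (cases q) auto
  qed (use p vw in auto)
  then obtain y z q where pq: "p = v # y # z # q" by blast
  have vy: "{v, y} \<in> E" "c {v, y} = c e'" and yz: "{y, z} \<in> E" "c {y, z} = c e'"
    using p(5) pq by (auto simp: color_arcs_def)
  have tail1: "(y, w) \<in> (?b \<inter> (- {v}) \<times> (- {v}))\<^sup>*"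
    using arcs_rtrancl_avoiding[of "y # z # q" ?b v] p(3-5) pq by auto
  have tail2: "(z, w) \<in> (?b \<inter> (- {y}) \<times> (- {y}))\<^sup>*"
    using arcs_rtrancl_avoiding[of "z # q" ?b y] p(3-5) pq by auto
  obtain X where X: "v \<in> X" "y \<notin> X" "inj_on c (edge_cut E X)" using tight[OF vy(1)] by blast
  obtain Y where Y: "y \<in> Y" "z \<notin> Y" "inj_on c (edge_cut E Y)" using tight[OF yz(1)] by blast
  \<comment> \<open>Otherwise the tail from \<open>y\<close>, which avoids \<open>v\<close>, would
    enter \<open>X\<close> along a second edge colored like \<open>vy\<close>, against injectivity.
    The same argument with the tail from \<open>z\<close> and the edge \<open>yz\<close> handles
    \<open>Y\<close>.\<close>
  have "w \<notin> X"
  proof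
    assume "w \<in> X"
    then obtain s t where "{s, t} \<in> E" "c {s, t} = c e'" "s \<noteq> v" "t \<noteq> v" "s \<notin> X" "t \<in> X"
      using rtrancl_crossing[OF tail1, of "- X"] X by (auto simp: color_arcs_def)
    moreover from this have "{s, t} = {v, y}"
      using X vy by (intro inj_onD[OF X(3)]) (auto simp: edge_cut_doubleton)
    ultimately show False by (auto simp: doubleton_eq_iff)
  qed
  have "w \<notin> Y"
  proof
    assume "w \<in> Y"
    then obtain s t where "{s, t} \<in> E" "c {s, t} = c e'" "s \<noteq> y" "t \<noteq> y" "s \<notin> Y" "t \<in> Y"
      using rtrancl_crossing[OF tail2, of "- Y"] Y by (auto simp: color_arcs_def)
    moreover from this have "{s, t} = {y, z}"
      using Y yz by (intro inj_onD[OF Y(3)]) (auto simp: edge_cut_doubleton)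
    ultimately show False by (auto simp: doubleton_eq_iff)
  qed
  \<comment> \<open>Otherwise \<open>vy\<close> and \<open>yz\<close>, of equal color, would both
    lie in the cut of \<open>Y\<close>.\<close>
  have "v \<in> Y"
  proof (rule ccontr)
    assume "v \<notin> Y"
    then have "{v, y} = {y, z}"
      using Y vy yz by (intro inj_onD[OF Y(3)]) (auto simp: edge_cut_doubleton)
    then show False using p pq by (auto simp: doubleton_eq_iff)
  qed
  have eX: "e \<in> edge_cut E X" and eY: "e \<in> edge_cut E Y"
    using ee(1) vw(1) X(1) \<open>w \<notin> X\<close> \<open>v \<in> Y\<close> \<open>w \<notin> Y\<close> by (auto simp: edge_cut_doubleton)
  have "y \<in> V" using simple_graph_doubleton[OF G vy(1)] by blast
  then have "(y, v) \<in> (color_arcs E c (c e))\<^sup>*" using color_class_connected[OF G min col ee(1) _ vw(2)] by blast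
  \<comment> \<open>An edge leaving \<open>Y - X\<close> crosses the boundary of \<open>X\<close> or
    of \<open>Y\<close>. In both cuts the only edge with the color of \<open>e\<close> is
    \<open>e\<close> itself, but \<open>v\<close> is in \<open>X\<close> and \<open>w\<close> is not
    in \<open>Y\<close>, so \<open>e\<close> has no end in \<open>Y - X\<close>.\<close>
  then obtain s t where st: "s \<in> Y - X" "t \<notin> Y - X" "{s, t} \<in> E" "c {s, t} = c e"
    using connected_color_meets_cut[of y v E c "c e" "Y - X"] X Y by (auto simp: edge_cut_doubleton)
  then have "{s, t} \<in> edge_cut E X \<or> {s, t} \<in> edge_cut E Y" by (auto simp: edge_cut_doubleton)
  then have "{s, t} = e" using st(4) eX eY inj_onD[OF X(3)] inj_onD[OF Y(3)] by metis
  then show False using st(1) vw(1) X(1) \<open>w \<notin> Y\<close> by (auto simp: doubleton_eq_iff)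
qed

theorem theorem2p11:
  fixes k :: nat and V :: "'a set" and E :: "'a set set"
  assumes "k \<ge> 2"
    and "simple_graph V E"
    and "minimally_edge_connected k V E"
  shows "mc k V E \<le> k - 1"
proof -
  have "edge_connected k V E" using assms(3) by (simp add: minimally_edge_connected_def)
  then show ?thesis
    using finite_color_numbers[OF assms(2), of k] color_numbers_nonempty[of k V E]
      MC_coloring_bound[OF assms] assms(1)
    unfolding mc_def by (subst Max_le_iff) fastforce+
qed

end
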